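(* Let $z_1,\dots,z_N\in\mathbb{C}$ (not necessarily distinct) and let $x_i\in\mathbb{S}^2$ with $\pi_{\mathbb{S}^2}(x_i)=z_i$, $1\le i\le N$. Then $$\frac{\prod_{i=1}^N\|x-z_i\|}{\big\|\prod_{i=1}^N(x-z_i)\big\|}=\frac{2^N}{\sqrt{N+1}}\Big(\int_{\mathbb{S}^2}\prod_{i=1}^N|p-x_i|^2\,d\sigma(p)\Big)^{-1/2},$$ where $\|\cdot\|$ is the Bombieri–Weyl norm and $\sigma$ is the normalized surface measure on $\mathbb{S}^2$.
   Context: $\mathbb{S}^2$ is the unit sphere in $\mathbb{R}^3$, $\sigma$ its surface measure with $\sigma(\mathbb{S}^2)=1$, and $\pi_{\mathbb{S}^2}(a,b,c)=\frac{a+ib}{1-c}$ the stereographic projection from the North pole. The Bombieri–Weyl norm of $P(z)=\sum_{i=0}^N a_iz^i$ of degree $N$ is $\|P\|=(\sum_{i=0}^N\binom{N}{i}^{-1}|a_i|^2)^{1/2}$. *)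

theory Defs
  imports "HOL-Analysis.Analysis" "HOL-Computational_Algebra.Polynomial"
begin

definition stereo :: "real^3 \<Rightarrow> complex" where
  "stereo p = Complex (p$1) (p$2) / complex_of_real (1 - p$3)"

definition bw_norm :: "complex poly \<Rightarrow> real" where
  "bw_norm P = sqrt (\<Sum>i\<le>degree P. (cmod (coeff P i))\<^sup>2 / real (degree P choose i))"

text \<open>Normalized surface measure on the unit sphere S^2, realised as the
  push-forward of the normalized Lebesgue measure on the unit ball under the
  radial projection p maps to p / norm p (the cone-measure construction of the
  uniform probability measure on the sphere).\<close>
definition sphere_sigma :: "(real^3) measure" where
  "sphere_sigma = distr (uniform_measure lborel (ball 0 1)) borel (\<lambda>p. p /\<^sub>R norm p)"

end

theory Submission
  imports Defs "HOL-Probability.Probability_Measure"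
begin

text \<open>A point \<open>p\<close> of the sphere is described by a spinor \<open>(u, v)\<close> with \<open>\<bar>u\<bar>\<^sup>2 = 1 + p\<^sub>3\<close>, \<open>\<bar>v\<bar>\<^sup>2 = 1 - p\<^sub>3\<close>
  and \<open>u * cnj v = p\<^sub>1 + \<i> p\<^sub>2\<close>. If \<open>x\<close> projects to \<open>z\<close>, then
  \<open>(1 + \<bar>z\<bar>\<^sup>2) \<bar>p - x\<bar>\<^sup>2 = 2 \<bar>u - z v\<bar>\<^sup>2\<close>, so the integrand is up to a constant the squared modulus of
  the homogenization \<open>\<Sum>j. a\<^sub>j u ^ j v ^ (N - j)\<close> of the polynomial. Its cross terms vanish after
  integration by rotation about the vertical axis. For the diagonal terms, differentiating along the
  rotations in the two vertical coordinate planes shows that the integrals of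
  \<open>(N choose j) (1 + p\<^sub>3) ^ j (1 - p\<^sub>3) ^ (N - j)\<close> do not depend on \<open>j\<close>; by the binomial theorem they add up
  to \<open>2 ^ N\<close>. This gives the Bombieri-Weyl weights.\<close>

section \<open>Rotation invariance of the surface measure\<close>

abbreviation unit_ball_measure :: "(real^3) measure" where
  "unit_ball_measure \<equiv> uniform_measure lborel (ball 0 1)"

lemma emeasure_unit_ball:
  "emeasure lborel (ball (0::real^3) 1) \<noteq> 0" "emeasure lborel (ball (0::real^3) 1) \<noteq> \<infinity>"
proof -
  have "measure lebesgue (ball (0::real^3) 1) \<noteq> 0"
    using content_ball_pos[of 1 "0::real^3"] by simp
  then show "emeasure lborel (ball (0::real^3) 1) \<noteq> 0"
    by (auto simp: measure_def)
  show "emeasure lborel (ball (0::real^3) 1) \<noteq> \<infinity>"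
    using emeasure_bounded_finite[of "ball (0::real^3) 1"] by auto
qed

lemma prob_space_unit_ball: "prob_space unit_ball_measure"
  using emeasure_unit_ball by (rule prob_space_uniform_measure)

lemma prob_space_sphere_sigma: "prob_space sphere_sigma"
  unfolding sphere_sigma_def
  by (rule prob_space.prob_space_distr[OF prob_space_unit_ball]) simp

lemma sets_sphere_sigma [simp, measurable_cong]: "sets sphere_sigma = sets borel"
  and space_sphere_sigma [simp]: "space sphere_sigma = UNIV"
  by (auto simp: sphere_sigma_def)

text \<open>The radial projection lands on the sphere except at the origin, which division by zero
  sends to 0; a single point is a Lebesgue null set.\<close>

lemma AE_sphere_sigma: "AE p in sphere_sigma. norm p = 1"
proof -
  have "AE p in lborel. p \<noteq> (0::real^3)"
    by (rule AE_lborel_singleton)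
  then have "AE p in unit_ball_measure. p \<noteq> 0"
    by (intro AE_uniform_measureI) auto
  then have "AE p in unit_ball_measure. norm (p /\<^sub>R norm p) = 1"
    by eventually_elim simp
  then show ?thesis
    unfolding sphere_sigma_def by (subst AE_distr_iff) auto
qed

lemma continuous_on_orthogonal_transformation:
  fixes T :: "'a::euclidean_space \<Rightarrow> 'a"
  assumes "orthogonal_transformation T"
  shows "continuous_on S T"
  using orthogonal_transformation_linear[OF assms]
  by (simp add: linear_continuous_on linear_linear)

text \<open>An orthogonal map preserves Lebesgue measure and maps the ball onto itself, so it
  carries the part of the ball lying over \<open>A\<close> onto the part of the ball inside
  \<open>A\<close>.\<close>

lemma distr_unit_ball_orthogonal:
  assumes T: "orthogonal_transformation (T :: real^3 \<Rightarrow> real^3)"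
  shows "distr unit_ball_measure borel T = unit_ball_measure"
proof (rule measure_eqI)
  show "sets (distr unit_ball_measure borel T) = sets unit_ball_measure"
    by simp
  fix A assume "A \<in> sets (distr unit_ball_measure borel T)"
  then have A [measurable]: "A \<in> sets borel" by simp
  have "continuous_on UNIV T"
    using T by (rule continuous_on_orthogonal_transformation)
  then have Tm [measurable]: "T \<in> borel_measurable borel"
    by (rule borel_measurable_continuous_onI)
  have pre: "T -` A \<in> sets borel"
    using measurable_sets[OF Tm A] by simp
  have "T ` ball 0 1 = ball 0 1"
    using image_orthogonal_transformation_ball[OF T, of 0 1] linear_0[OF orthogonal_transformation_linear[OF T]]
    by simp
  moreover have "T ` (ball 0 1 \<inter> T -` A) = T ` ball 0 1 \<inter> A"
    by blast
  ultimately have image: "T ` (ball 0 1 \<inter> T -` A) = ball 0 1 \<inter> A"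
    by simp
  \<comment> \<open>Equal values of \<open>measure\<close> give equal values of
    \<open>emeasure\<close> only where the latter is finite, hence the bound by the ball.\<close>
  have fin: "emeasure lborel B \<noteq> \<infinity>" if "B \<subseteq> ball 0 1" for B :: "(real^3) set"
    using emeasure_bounded_finite[of B] bounded_subset[OF bounded_ball that] by auto
  have lm: "ball 0 1 \<inter> T -` A \<in> lmeasurable"
    using pre by (intro bounded_set_imp_lmeasurable) (auto intro: bounded_subset[OF bounded_ball])
  have "measure lborel (ball 0 1 \<inter> T -` A) = measure lborel (ball 0 1 \<inter> A)"
    using measure_orthogonal_image[OF T lm] pre by (simp add: image)
  then have "emeasure lborel (ball 0 1 \<inter> T -` A) = emeasure lborel (ball 0 1 \<inter> A)"
    using fin by (simp add: emeasure_eq_ennreal_measure)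
  then show "emeasure (distr unit_ball_measure borel T) A = emeasure unit_ball_measure A"
    using pre by (simp add: emeasure_distr)
qed

text \<open>Since \<open>T\<close> is linear and preserves norms, it commutes with the radial
  projection, so invariance descends from the ball to the sphere.\<close>

lemma sphere_sigma_orthogonal:
  fixes f :: "real^3 \<Rightarrow> 'b::{banach, second_countable_topology}"
  assumes T: "orthogonal_transformation T" and f [measurable]: "f \<in> borel_measurable borel"
  shows "(\<integral>p. f (T p) \<partial>sphere_sigma) = (\<integral>p. f p \<partial>sphere_sigma)"
proof -
  have "continuous_on UNIV T"
    using T by (rule continuous_on_orthogonal_transformation)
  then have [measurable]: "T \<in> borel_measurable borel"
    by (rule borel_measurable_continuous_onI)
  have eq: "T (p /\<^sub>R norm p) = T p /\<^sub>R norm (T p)" for p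
    using T by (simp add: orthogonal_transformation linear_cmul)
  have "(\<integral>p. f (T p) \<partial>sphere_sigma) = (\<integral>p. f (T p /\<^sub>R norm (T p)) \<partial>unit_ball_measure)"
    by (simp add: sphere_sigma_def integral_distr eq)
  also have "\<dots> = (\<integral>p. f (p /\<^sub>R norm p) \<partial>distr unit_ball_measure borel T)"
    by (simp add: integral_distr)
  also have "\<dots> = (\<integral>p. f p \<partial>sphere_sigma)"
    unfolding distr_unit_ball_orthogonal[OF T] by (simp add: sphere_sigma_def integral_distr)
  finally show ?thesis .
qed

lemma continuous_bounded_on_sphere:
  fixes f :: "real^3 \<Rightarrow> 'b::real_normed_vector"
  assumes "continuous_on UNIV f"
  obtains B where "\<And>p. norm p = 1 \<Longrightarrow> norm (f p) \<le> B"
proof -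
  have "compact (f ` sphere 0 1)"
    by (intro compact_continuous_image continuous_on_subset[OF assms]) auto
  then obtain B where "\<forall>y \<in> f ` sphere 0 1. norm y \<le> B"
    using compact_imp_bounded bounded_iff by blast
  then show thesis
    by (intro that[of B]) auto
qed

text \<open>A continuous function may be unbounded on the whole space, but it is bounded on the
  compact sphere, which carries all the mass of this finite measure.\<close>

lemma integrable_sphere_sigma:
  fixes f :: "real^3 \<Rightarrow> 'b::{banach, second_countable_topology}"
  assumes "continuous_on UNIV f"
  shows "integrable sphere_sigma f"
proof -
  obtain B where B: "\<And>p. norm p = 1 \<Longrightarrow> norm (f p) \<le> B"
    using continuous_bounded_on_sphere[OF assms] by blast
  have "f \<in> borel_measurable borel"
    using assms by (rule borel_measurable_continuous_onI)
  then show ?thesis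
    by (intro finite_measure.integrable_const_bound[of _ _ B]
          prob_space.finite_measure[OF prob_space_sphere_sigma])
       (use AE_sphere_sigma in \<open>auto simp: B elim: eventually_mono\<close>)
qed

text \<open>Allows identities that depend on \<open>norm p = 1\<close> to be used under the integral
  sign.\<close>

lemma integral_cong_sphere:
  fixes f g :: "real^3 \<Rightarrow> 'b::{banach, second_countable_topology}"
  assumes "continuous_on UNIV f" "continuous_on UNIV g" "\<And>p. norm p = 1 \<Longrightarrow> f p = g p"
  shows "(\<integral>p. f p \<partial>sphere_sigma) = (\<integral>p. g p \<partial>sphere_sigma)"
proof (rule integral_cong_AE)
  show "AE p in sphere_sigma. f p = g p"
    using AE_sphere_sigma by eventually_elim (rule assms(3))
qed (simp_all add: assms integrable_sphere_sigma borel_measurable_integrable)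

section \<open>Differentiation along rotations\<close>

definition rot :: "3 \<Rightarrow> 3 \<Rightarrow> real \<Rightarrow> real^3 \<Rightarrow> real^3" where
  "rot i j t p = (\<chi> k. if k = i then cos t * p$i + sin t * p$j
                       else if k = j then cos t * p$j - sin t * p$i else p$k)"

lemma orthogonal_transformation_rot:
  assumes "i \<noteq> j"
  shows "orthogonal_transformation (rot i j t)"
proof -
  have "linear (rot i j t)"
    by (rule linearI) (auto simp: rot_def vec_eq_iff algebra_simps)
  moreover have "norm (rot i j t p) = norm p" for p
  proof -
    have eq: "(cos t * a + sin t * b)\<^sup>2 + (cos t * b - sin t * a)\<^sup>2 = a\<^sup>2 + b\<^sup>2" for a b
    proof -
      have "(cos t * a + sin t * b)\<^sup>2 + (cos t * b - sin t * a)\<^sup>2 = ((cos t)\<^sup>2 + (sin t)\<^sup>2) * (a\<^sup>2 + b\<^sup>2)"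
        by algebra
      then show ?thesis by simp
    qed
    have "rot i j t p \<bullet> rot i j t p = p \<bullet> p"
      using assms exhaust_3[of i] exhaust_3[of j] eq[of "p$i" "p$j"]
      by (elim disjE) (simp_all add: inner_vec_def sum_3 rot_def power2_eq_square[symmetric] add_ac)
    then show ?thesis
      by (simp add: norm_eq_sqrt_inner)
  qed
  ultimately show ?thesis
    by (simp add: orthogonal_transformation)
qed

text \<open>By invariance the integral of \<open>g\<close> composed with \<open>rot i j t\<close> is
  constant in t. Its derivative at 0 vanishes, and dominated convergence moves that derivative
  inside the integral.\<close>

lemma integral_derivative_along_rot:
  fixes g g' :: "real^3 \<Rightarrow> real"
  assumes ij: "i \<noteq> j" and g: "continuous_on UNIV g" and g': "continuous_on UNIV g'"
    and deriv: "\<And>t p. ((\<lambda>t. g (rot i j t p)) has_field_derivative g' (rot i j t p)) (at t)"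
  shows "(\<integral>p. g' p \<partial>sphere_sigma) = 0"
proof -
  have rot0: "rot i j 0 p = p" for p
    by (simp add: rot_def vec_eq_iff)
  have norm_rot: "norm (rot i j t p) = norm p" for t p
    using orthogonal_transformation_rot[OF ij] by (simp add: orthogonal_transformation)
  obtain B where B: "\<And>p. norm p = 1 \<Longrightarrow> norm (g' p) \<le> B"
    using continuous_bounded_on_sphere[OF g'] by blast
  \<comment> \<open>The limit is taken along positive steps 1/(n+1), so that dominated convergence
    for sequences applies and no quotient has denominator 0.\<close>
  define h where "h n = inverse (real (Suc n))" for n
  have h: "h \<longlonglongrightarrow> 0" "h n > 0" for n
    unfolding h_def using LIMSEQ_inverse_real_of_nat by auto
  define d where "d n p = (g (rot i j (h n) p) - g p) / h n" for n p
  have [measurable]: "g \<in> borel_measurable borel" "g' \<in> borel_measurable borel"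
    using g g' by (auto intro: borel_measurable_continuous_onI)
  have rotc: "continuous_on UNIV (rot i j t)" for t
    using orthogonal_transformation_rot[OF ij] by (rule continuous_on_orthogonal_transformation)
  then have [measurable]: "rot i j t \<in> borel_measurable borel" for t
    by (rule borel_measurable_continuous_onI)
  have "(\<lambda>n. \<integral>p. d n p \<partial>sphere_sigma) \<longlonglongrightarrow> (\<integral>p. g' p \<partial>sphere_sigma)"
  proof (rule integral_dominated_convergence[where w = "\<lambda>_. B"])
    show "integrable sphere_sigma (\<lambda>_. B)"
      by (rule integrable_sphere_sigma) simp
    show "AE p in sphere_sigma. (\<lambda>n. d n p) \<longlonglongrightarrow> g' p"
    proof (rule AE_I2)
      fix p
      have "((\<lambda>t. (g (rot i j (0 + t) p) - g (rot i j 0 p)) / t) \<longlongrightarrow> g' (rot i j 0 p)) (at 0)"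
        using deriv[of p 0] unfolding DERIV_def .
      moreover have "filterlim h (at 0) sequentially"
        using h by (intro filterlim_atI) (auto simp: less_imp_neq[symmetric])
      ultimately show "(\<lambda>n. d n p) \<longlonglongrightarrow> g' p"
        unfolding d_def by (auto simp: rot0 dest: filterlim_compose)
    qed
    show "AE p in sphere_sigma. norm (d n p) \<le> B" for n
      using AE_sphere_sigma
    proof eventually_elim
      fix p :: "real^3" assume "norm p = 1"
      \<comment> \<open>Mean value inequality along the orbit of p: the orbit stays on the sphere,
        where \<open>B\<close> bounds the derivative.\<close>
      then have "norm (g (rot i j (h n) p) - g (rot i j 0 p)) \<le> B * norm (h n - 0)"
        by (intro field_differentiable_bound[of UNIV "\<lambda>t. g (rot i j t p)" "\<lambda>t. g' (rot i j t p)"])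
           (auto intro!: deriv B simp: norm_rot simp del: real_norm_def)
      then show "norm (d n p) \<le> B"
        using h(2)[of n] by (simp add: d_def rot0 field_simps)
    qed
  qed (auto simp: d_def)
  moreover have "(\<integral>p. d n p \<partial>sphere_sigma) = 0" for n
  proof -
    have "(\<integral>p. g (rot i j (h n) p) - g p \<partial>sphere_sigma) =
          (\<integral>p. g (rot i j (h n) p) \<partial>sphere_sigma) - (\<integral>p. g p \<partial>sphere_sigma)"
      by (intro Bochner_Integration.integral_diff integrable_sphere_sigma g
            continuous_on_compose2[OF g rotc]) auto
    also have "\<dots> = 0"
      by (simp add: sphere_sigma_orthogonal[OF orthogonal_transformation_rot[OF ij]])
    finally show ?thesis
      by (simp add: d_def)
  qed
  ultimately show ?thesis
    using LIMSEQ_unique[of "\<lambda>n. 0::real"] by force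
qed

section \<open>Moments of the height\<close>

text \<open>The integrand is the derivative of (1 - c^2) f(c) at c = \<open>p$3\<close>, a function
  vanishing at c = -1 and c = 1; the identity reflects that the height is uniformly distributed on
  [-1, 1]. It follows by adding the derivatives of \<open>p$i * f (p$3)\<close> along the rotations
  in the planes (1,3) and (2,3).\<close>

lemma integral_derivative_height:
  fixes f f' :: "real \<Rightarrow> real"
  assumes f: "\<And>c. (f has_field_derivative f' c) (at c)" and f': "continuous_on UNIV f'"
  shows "(\<integral>p. (1 - (p$3)\<^sup>2) * f' (p$3) - 2 * p$3 * f (p$3) \<partial>sphere_sigma) = 0"
proof -
  have fc: "continuous_on UNIV f"
    using f by (meson DERIV_continuous_on has_field_derivative_at_within)
  have cont [continuous_intros]: "continuous_on UNIV (\<lambda>p::real^3. f (p$3))" "continuous_on UNIV (\<lambda>p::real^3. f' (p$3))"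
    by (rule continuous_on_compose2[OF fc] continuous_on_compose2[OF f']; auto intro!: continuous_intros)+
  define g where "g i p = p$3 * f (p$3) - (p$i)\<^sup>2 * f' (p$3)" for i :: 3 and p :: "real^3"
  have gc: "continuous_on UNIV (g i)" for i
    unfolding g_def by (intro continuous_intros)
  have zero: "(\<integral>p. g i p \<partial>sphere_sigma) = 0" if "i \<noteq> 3" for i
  proof (rule integral_derivative_along_rot[of i 3 "\<lambda>p. p$i * f (p$3)"])
    fix t p
    \<comment> \<open>Along this rotation the height has derivative minus coordinate i, while
      coordinate i has derivative the height; the product rule then yields
      \<open>g i\<close>.\<close>
    have "((\<lambda>t. cos t * p$3 - sin t * p$i) has_field_derivative - rot i 3 t p $ i) (at t)"
      by (auto intro!: derivative_eq_intros simp: rot_def)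
    from DERIV_chain2[OF f this]
    have 1: "((\<lambda>t. f (rot i 3 t p $ 3)) has_field_derivative f' (rot i 3 t p $ 3) * (- rot i 3 t p $ i)) (at t)"
      using that by (simp add: rot_def)
    have 2: "((\<lambda>t. rot i 3 t p $ i) has_field_derivative rot i 3 t p $ 3) (at t)"
      using that by (auto intro!: derivative_eq_intros simp: rot_def)
    show "((\<lambda>t. rot i 3 t p $ i * f (rot i 3 t p $ 3)) has_field_derivative g i (rot i 3 t p)) (at t)"
      using DERIV_mult[OF 2 1] by (simp add: g_def power2_eq_square algebra_simps)
  qed (use that gc in \<open>auto intro!: continuous_intros\<close>)
  have "(\<integral>p. (1 - (p$3)\<^sup>2) * f' (p$3) - 2 * p$3 * f (p$3) \<partial>sphere_sigma)
      = (\<integral>p. - (g 1 p + g 2 p) \<partial>sphere_sigma)"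
  proof (rule integral_cong_sphere)
    fix p :: "real^3" assume "norm p = 1"
    then have "1 - (p$3)\<^sup>2 = (p$1)\<^sup>2 + (p$2)\<^sup>2"
      by (simp add: norm_eq_1 inner_vec_def sum_3 power2_eq_square)
    then show "(1 - (p$3)\<^sup>2) * f' (p$3) - 2 * p$3 * f (p$3) = - (g 1 p + g 2 p)"
      unfolding g_def by algebra
  qed (intro continuous_intros gc)+
  also have "\<dots> = 0"
    by (simp add: zero integrable_sphere_sigma gc)
  finally show ?thesis .
qed

text \<open>This is the preceding identity for f(c) = (1 + c)^j (1 - c)^k: since 1 - c^2 = (1 + c)(1
  - c), the terms regroup into the two moments.\<close>

lemma sphere_moment_step:
  "real (Suc k) * (\<integral>p. (1 + p$3) ^ Suc j * (1 - p$3) ^ k \<partial>sphere_sigma)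
 = real (Suc j) * (\<integral>p. (1 + p$3) ^ j * (1 - p$3) ^ Suc k \<partial>sphere_sigma)"
proof -
  \<comment> \<open>For exponent 0 the truncated \<open>j - 1\<close> or \<open>k - 1\<close> is
    harmless, because the factor \<open>real j\<close> or \<open>real k\<close> is then 0.\<close>
  have j: "(1 + c) * (real j * (1 + c) ^ (j - 1)) = real j * (1 + c) ^ j"
    and k: "(1 - c) * (real k * (1 - c) ^ (k - 1)) = real k * (1 - c) ^ k" for c
    by (cases j; simp) (cases k; simp)
  define f where "f c = (1 + c) ^ j * (1 - c) ^ k" for c :: real
  define f' where "f' c = real j * (1 + c) ^ (j - 1) * (1 - c) ^ k - real k * (1 + c) ^ j * (1 - c) ^ (k - 1)"
    for c :: real
  have id: "(1 - c\<^sup>2) * f' c - 2 * c * f c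
      = real (Suc j) * ((1 + c) ^ j * (1 - c) ^ Suc k) - real (Suc k) * ((1 + c) ^ Suc j * (1 - c) ^ k)" for c
  proof -
    have "(1 - c\<^sup>2) * f' c = (1 - c) * (1 - c) ^ k * ((1 + c) * (real j * (1 + c) ^ (j - 1)))
           - (1 + c) * (1 + c) ^ j * ((1 - c) * (real k * (1 - c) ^ (k - 1)))"
      by (simp add: f'_def power2_eq_square algebra_simps)
    then show ?thesis
      unfolding j k by (simp add: f_def algebra_simps)
  qed
  have "(\<integral>p. (1 - (p$3)\<^sup>2) * f' (p$3) - 2 * p$3 * f (p$3) \<partial>sphere_sigma) = 0"
    by (rule integral_derivative_height)
      (auto simp: f_def f'_def intro!: derivative_eq_intros continuous_intros)
  then have "0 = (\<integral>p. real (Suc j) * ((1 + p$3) ^ j * (1 - p$3) ^ Suc k)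
      - real (Suc k) * ((1 + p$3) ^ Suc j * (1 - p$3) ^ k) \<partial>sphere_sigma)"
    unfolding id by simp
  also have "\<dots> = real (Suc j) * (\<integral>p. (1 + p$3) ^ j * (1 - p$3) ^ Suc k \<partial>sphere_sigma)
      - real (Suc k) * (\<integral>p. (1 + p$3) ^ Suc j * (1 - p$3) ^ k \<partial>sphere_sigma)"
    by (subst Bochner_Integration.integral_diff)
      (auto intro!: integrable_sphere_sigma continuous_intros simp del: power_Suc)
  finally show ?thesis by simp
qed

text \<open>The step relation and the ratio of neighbouring binomial coefficients make
  \<open>real (N choose k) * M k\<close> independent of k. The N + 1 equal values add up to 2^N by
  expanding ((1 + c) + (1 - c))^N.\<close>

lemma sphere_moment:
  assumes "k \<le> N"
  shows "(\<integral>p. (1 + p$3) ^ k * (1 - p$3) ^ (N - k) \<partial>sphere_sigma)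
       = 2 ^ N / (real (Suc N) * real (N choose k))"
proof -
  define M where "M k = (\<integral>p. (1 + p$3) ^ k * (1 - p$3) ^ (N - k) \<partial>sphere_sigma)" for k
  have step: "real (N choose Suc k) * M (Suc k) = real (N choose k) * M k" if "k < N" for k
  proof -
    have M: "real (N - k) * M (Suc k) = real (Suc k) * M k"
      using sphere_moment_step[of "N - Suc k" k] that by (simp add: M_def Suc_diff_Suc del: of_nat_Suc power_Suc)
    have "Suc k * (N choose Suc k) = (N - k) * (N choose k)"
      by (simp only: binomial_absorption binomial_absorb_comp)
    then have C: "real (Suc k) * real (N choose Suc k) = real (N - k) * real (N choose k)"
      by (metis of_nat_mult)
    have "real (Suc k) * (real (N choose Suc k) * M (Suc k)) = (real (N - k) * M (Suc k)) * real (N choose k)"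
      using C by (metis mult.assoc mult.commute)
    also have "\<dots> = real (Suc k) * (real (N choose k) * M k)"
      unfolding M by simp
    finally show ?thesis by (simp del: of_nat_Suc)
  qed
  have const: "real (N choose k) * M k = M 0" if "k \<le> N" for k
    using that by (induction k) (auto simp: step)
  have "2 ^ N = (\<integral>p. (2::real) ^ N \<partial>sphere_sigma)"
    using prob_space.prob_space[OF prob_space_sphere_sigma] by simp
  also have "\<dots> = (\<integral>p. (\<Sum>k\<le>N. real (N choose k) * ((1 + p$3) ^ k * (1 - p$3) ^ (N - k))) \<partial>sphere_sigma)"
  proof -
    have "(2::real) ^ N = (\<Sum>k\<le>N. real (N choose k) * ((1 + c) ^ k * (1 - c) ^ (N - k)))" for c
      using binomial_ring[of "1 + c" "1 - c" N] by (simp add: mult.assoc)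
    then show ?thesis by simp
  qed
  also have "\<dots> = (\<Sum>k\<le>N. real (N choose k) * M k)"
    unfolding M_def
    by (subst Bochner_Integration.integral_sum) (auto intro!: integrable_sphere_sigma continuous_intros)
  also have "\<dots> = real (Suc N) * M 0"
    by (simp add: const)
  finally have "real (Suc N) * (real (N choose k) * M k) = 2 ^ N"
    using const[OF assms] by simp
  then have "M k = 2 ^ N / (real (Suc N) * real (N choose k))"
    using assms by (simp add: field_simps del: of_nat_Suc)
  then show ?thesis
    by (simp add: M_def)
qed

section \<open>Spinor coordinates and the orthogonality of monomials\<close>

abbreviation horiz :: "real^3 \<Rightarrow> complex" where
  "horiz p \<equiv> Complex (p$1) (p$2)"

text \<open>The value of \<open>u ^ j * v ^ (N - j) * cnj (u ^ k * v ^ (N - k))\<close> for a spinor \<open>(u, v)\<close> over \<open>p\<close>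
  (see \<open>cross_term_spinor\<close>), written as a polynomial in \<open>p\<close> so that it is continuous at the North pole;
  the truncated differences make one of the first two factors equal to 1.\<close>
definition cross_term :: "nat \<Rightarrow> nat \<Rightarrow> nat \<Rightarrow> real^3 \<Rightarrow> complex" where
  "cross_term N j k p = horiz p ^ (j - k) * cnj (horiz p) ^ (k - j)
     * of_real ((1 + p$3) ^ min j k * (1 - p$3) ^ (N - max j k))"

lemma continuous_on_cross_term: "continuous_on UNIV (cross_term N j k)"
proof -
  have "continuous_on UNIV horiz"
    unfolding Complex_eq by (intro continuous_intros)
  then show ?thesis
    unfolding cross_term_def by (intro continuous_intros)
qed

lemma integral_cross_term:
  assumes "j \<le> N" "k \<le> N"
  shows "(\<integral>p. cross_term N j k p \<partial>sphere_sigma)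
       = (if j = k then of_real (2 ^ N / (real (Suc N) * real (N choose k))) else 0)"
proof (cases "j = k")
  case True
  then have "cross_term N j k = (\<lambda>p. of_real ((1 + p$3) ^ k * (1 - p$3) ^ (N - k)))"
    by (simp add: cross_term_def fun_eq_iff)
  then show ?thesis
    using True assms by (simp only: integral_complex_of_real sphere_moment) simp
next
  case False
  \<comment> \<open>A rotation about the vertical axis by this angle multiplies the cross term by
    the phase exp(-i t (j - k)) = exp(-i pi) = -1, so the integral equals its own negative.\<close>
  define t where "t = pi / (real j - real k)"
  have horiz: "horiz (rot 1 2 t p) = cis (- t) * horiz p" for p
    by (simp add: rot_def complex_eq_iff)
  have third: "rot 1 2 t p $ 3 = p $ 3" for p
    by (simp add: rot_def)
  have factor: "cis (- t) ^ (j - k) * cnj (cis (- t)) ^ (k - j) = -1"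
  proof (cases "k < j")
    case True
    then have "real (j - k) * t = pi"
      by (simp add: t_def of_nat_diff)
    then have "cis (- t) ^ (j - k) = cis (- pi)"
      using Complex.DeMoivre[of "- t" "j - k"] by simp
    then show ?thesis
      using True by (simp add: complex_eq_iff)
  next
    case False
    then have "real (k - j) * t = - pi"
      using \<open>j \<noteq> k\<close> by (simp add: t_def of_nat_diff field_simps)
    then have "cis t ^ (k - j) = cis (- pi)"
      using Complex.DeMoivre[of t "k - j"] by simp
    then show ?thesis
      using False by (simp add: cis_cnj complex_eq_iff)
  qed
  have "cross_term N j k (rot 1 2 t p)
      = cis (- t) ^ (j - k) * cnj (cis (- t)) ^ (k - j) * cross_term N j k p" for p
    unfolding cross_term_def horiz third power_mult_distrib complex_cnj_mult by (simp only: mult_ac)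
  then have "cross_term N j k (rot 1 2 t p) = - cross_term N j k p" for p
    unfolding factor by simp
  then have "(\<integral>p. cross_term N j k p \<partial>sphere_sigma) = - (\<integral>p. cross_term N j k p \<partial>sphere_sigma)"
    using sphere_sigma_orthogonal[OF orthogonal_transformation_rot[of 1 2 t],
        OF _ borel_measurable_continuous_onI[OF continuous_on_cross_term[of N j k]]]
    by simp
  then show ?thesis
    using False by simp
qed

text \<open>Away from the North pole take v = sqrt(1 - \<open>p$3\<close>) and u =
  \<open>horiz p\<close> / v; the modulus of u is right because |\<open>horiz p\<close>|^2 = (1 +
  \<open>p$3\<close>)(1 - \<open>p$3\<close>) on the sphere. At the pole v vanishes and u = sqrt 2
  serves.\<close>

lemma spinor_exists:
  assumes "norm (p::real^3) = 1"
  obtains u v where "u * cnj u = of_real (1 + p$3)" "v * cnj v = of_real (1 - p$3)" "u * cnj v = horiz p"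
proof -
  have p: "(p$1)\<^sup>2 + (p$2)\<^sup>2 = (1 + p$3) * (1 - p$3)"
    using assms by (simp add: norm_eq_1 inner_vec_def sum_3 power2_eq_square algebra_simps)
  have le: "p$3 \<le> 1"
    using component_le_norm_cart[of p 3] assms by simp
  show thesis
  proof (cases "p$3 = 1")
    case True
    then have "p$1 = 0" "p$2 = 0"
      using p by (auto simp: sum_power2_eq_zero_iff)
    with True show thesis
      by (intro that[of "of_real (sqrt 2)" 0]) (auto simp: complex_eq_iff simp flip: of_real_mult)
  next
    case False
    define s where "s = sqrt (1 - p$3)"
    have s: "s * s = 1 - p$3" "s \<noteq> 0"
      using le False by (auto simp: s_def)
    have "horiz p * cnj (horiz p) = of_real ((1 + p$3) * (1 - p$3))"
      unfolding p[symmetric] by (simp add: complex_mult_cnj)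
    also have "\<dots> = of_real (1 + p$3) * (of_real s * of_real s)"
      unfolding s(1)[symmetric] by simp
    finally have "(horiz p / of_real s) * cnj (horiz p / of_real s) = of_real (1 + p$3)"
      using s(2) by (simp add: field_simps)
    then show thesis
      using s by (intro that[of "horiz p / of_real s" "of_real s"]) (simp_all flip: of_real_mult)
  qed
qed

lemma cross_term_spinor:
  assumes "u * cnj u = of_real (1 + p$3)" "v * cnj v = of_real (1 - p$3)" "u * cnj v = horiz p"
    and "j \<le> N" "k \<le> N"
  shows "u ^ j * v ^ (N - j) * cnj (u ^ k * v ^ (N - k)) = cross_term N j k p"
proof -
  have *: "cross_term N j k p =
     (u * cnj v) ^ (j - k) * (cnj u * v) ^ (k - j) * ((u * cnj u) ^ min j k * (v * cnj v) ^ (N - max j k))"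
    unfolding cross_term_def assms(3)[symmetric] assms(1,2) by simp
  show ?thesis
  \<comment> \<open>Ordering j, k and N by explicit differences \<open>d\<close> and
    \<open>e\<close> removes all truncated subtractions, leaving equal monomials.\<close>
  proof (cases "j \<le> k")
    case True
    then obtain d where d: "k = j + d" using le_Suc_ex by blast
    obtain e where e: "N = k + e" using assms(5) le_Suc_ex by blast
    show ?thesis unfolding * by (simp add: d e power_add power_mult_distrib)
  next
    case False
    then obtain d where d: "j = k + d" using le_Suc_ex nat_le_linear by blast
    obtain e where e: "N = j + e" using assms(4) le_Suc_ex by blast
    show ?thesis unfolding * by (simp add: d e power_add power_mult_distrib)
  qed
qed

text \<open>With z = a + ib both sides reduce to the same expression in p: |u - z v|^2 has cross
  term -2 Re(cnj z * \<open>horiz p\<close>), and |p - x|^2 = 2 - 2 (p . x) with x expressed through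
  z.\<close>

lemma norm_diff_spinor:
  assumes u: "u * cnj u = of_real (1 + p$3)" and v: "v * cnj v = of_real (1 - p$3)" and uv: "u * cnj v = horiz p"
    and p: "norm p = 1" and x: "norm x = 1" "x$3 \<noteq> 1"
  shows "(1 + (cmod (stereo x))\<^sup>2) * (norm (p - x))\<^sup>2 = 2 * (cmod (u - stereo x * v))\<^sup>2"
proof -
  obtain a b where z: "stereo x = Complex a b" by (cases "stereo x")
  have "horiz x = stereo x * of_real (1 - x$3)"
    using x(2) by (simp add: stereo_def)
  then have ab: "x$1 = a * (1 - x$3)" "x$2 = b * (1 - x$3)"
    by (simp_all add: z complex_eq_iff)
  have n: "x$1 * x$1 + x$2 * x$2 + x$3 * x$3 = 1" "p$1 * p$1 + p$2 * p$2 + p$3 * p$3 = 1"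
    using x p by (simp_all add: norm_eq_1 inner_vec_def sum_3)
  \<comment> \<open>The sphere equation for x contains the factor \<open>1 - x$3\<close>, nonzero
    away from the pole; cancelling it makes the relation between z and the height linear in
    \<open>x$3\<close>.\<close>
  have "(1 - x$3) * ((a\<^sup>2 + b\<^sup>2) * (1 - x$3)) = (1 - x$3) * (1 + x$3)"
    using n(1) unfolding ab by algebra
  then have c: "(a\<^sup>2 + b\<^sup>2) * (1 - x$3) = 1 + x$3"
    using x(2) by simp
  have "(norm (p - x))\<^sup>2 = 2 - 2 * (p$1 * x$1 + p$2 * x$2 + p$3 * x$3)"
    using n by (simp add: power2_norm_eq_inner inner_vec_def sum_3 algebra_simps)
  also have "\<dots> = 2 - 2 * ((p$1 * a + p$2 * b) * (1 - x$3) + p$3 * x$3)"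
    unfolding ab by (simp add: algebra_simps)
  finally have d: "(1 + (a\<^sup>2 + b\<^sup>2)) * (norm (p - x))\<^sup>2
      = 2 * ((1 + p$3) + (a\<^sup>2 + b\<^sup>2) * (1 - p$3) - 2 * (p$1 * a + p$2 * b))"
    using c by algebra
  have uvr: "Re u * Re v + Im u * Im v = p$1" "Im u * Re v - Re u * Im v = p$2"
      "(Re u)\<^sup>2 + (Im u)\<^sup>2 = 1 + p$3" "(Re v)\<^sup>2 + (Im v)\<^sup>2 = 1 - p$3"
    using u v uv by (auto simp: complex_eq_iff power2_eq_square)
  have "(cmod (u - stereo x * v))\<^sup>2 = (1 + p$3) + (a\<^sup>2 + b\<^sup>2) * (1 - p$3) - 2 * (p$1 * a + p$2 * b)"
    unfolding z cmod_power2 uvr[symmetric] by (simp add: power2_eq_square algebra_simps)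
  with d show ?thesis
    by (simp add: z cmod_power2)
qed

section \<open>Homogenization and the integral of the product\<close>

lemma prod_linear_homogenized:
  fixes z :: "'i \<Rightarrow> 'a::field"
  assumes "finite I"
  shows "(\<Prod>i\<in>I. u - z i * v) = (\<Sum>j\<le>card I. coeff (\<Prod>i\<in>I. [:- z i, 1:]) j * (u ^ j * v ^ (card I - j)))"
proof -
  define P where "P = (\<Prod>i\<in>I. [:- z i, 1:])"
  have deg: "degree P = card I"
    by (simp add: P_def degree_prod_eq_sum_degree)
  have "lead_coeff P = 1"
    unfolding P_def lead_coeff_prod by simp
  then have lc: "coeff P (card I) = 1"
    by (simp add: deg)
  show ?thesis
  proof (cases "v = 0")
    case True
    \<comment> \<open>For v = 0 only the top index survives, where the exponent of v is 0; its
      coefficient is 1 because \<open>P\<close> is monic.\<close>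
    have "(\<Sum>j\<le>card I. coeff P j * (u ^ j * v ^ (card I - j)))
        = (\<Sum>j\<in>{card I}. coeff P j * (u ^ j * v ^ (card I - j)))"
      using True by (intro sum.mono_neutral_right) (auto simp: power_0_left)
    then show ?thesis
      using True lc by (simp add: P_def)
  next
    case False
    have "(\<Prod>i\<in>I. u - z i * v) = (\<Prod>i\<in>I. v * poly [:- z i, 1:] (u / v))"
      using False by (intro prod.cong) (auto simp: field_simps)
    also have "\<dots> = v ^ card I * poly P (u / v)"
      by (simp add: P_def poly_prod prod.distrib)
    also have "\<dots> = (\<Sum>j\<le>card I. coeff P j * (u ^ j * v ^ (card I - j)))"
      using False by (auto simp: poly_altdef deg sum_distrib_left power_divide power_diff intro!: sum.cong)
    finally show ?thesis
      by (simp add: P_def)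
  qed
qed

text \<open>Squared form of the main identity. Clearing the factors 1 + |z_i|^2 turns the integrand
  into 2^N |S|^2 with S the homogenized polynomial; of its double sum only the diagonal survives
  integration, with the Bombieri-Weyl weights.\<close>

lemma integral_norm_prod_sphere:
  fixes x :: "'i \<Rightarrow> real^3"
  assumes I: "finite I" and x: "\<And>i. i \<in> I \<Longrightarrow> norm (x i) = 1" "\<And>i. i \<in> I \<Longrightarrow> x i $ 3 \<noteq> 1"
  defines "N \<equiv> card I" and "P \<equiv> \<Prod>i\<in>I. [:- stereo (x i), 1:]"
  shows "(\<integral>p. (\<Prod>i\<in>I. (norm (p - x i))\<^sup>2) \<partial>sphere_sigma)
       = 4 ^ N * (bw_norm P)\<^sup>2 / (real (N + 1) * (\<Prod>i\<in>I. 1 + (cmod (stereo (x i)))\<^sup>2))"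
proof -
  let ?z = "\<lambda>i. stereo (x i)"
  define D where "D = (\<Prod>i\<in>I. 1 + (cmod (?z i))\<^sup>2)"
  have pos: "1 + (cmod (?z i))\<^sup>2 > 0" for i
    by (simp add: add_pos_nonneg)
  then have D: "D > 0"
    unfolding D_def by (intro prod_pos) auto
  have deg: "degree P = N"
    by (simp add: P_def N_def degree_prod_eq_sum_degree)
  have expand: "of_real (D * (\<Prod>i\<in>I. (norm (p - x i))\<^sup>2))
      = 2 ^ N * (\<Sum>j\<le>N. \<Sum>k\<le>N. coeff P j * cnj (coeff P k) * cross_term N j k p)"
    if p: "norm p = 1" for p
  proof -
    obtain u v where uv: "u * cnj u = of_real (1 + p$3)" "v * cnj v = of_real (1 - p$3)" "u * cnj v = horiz p"
      using spinor_exists[OF p] by blast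
    define S where "S = (\<Sum>j\<le>N. coeff P j * (u ^ j * v ^ (N - j)))"
    have "D * (\<Prod>i\<in>I. (norm (p - x i))\<^sup>2) = (\<Prod>i\<in>I. 2 * (cmod (u - ?z i * v))\<^sup>2)"
      unfolding D_def prod.distrib[symmetric]
      using norm_diff_spinor[OF uv p] x by (intro prod.cong) auto
    also have "\<dots> = 2 ^ N * (cmod (\<Prod>i\<in>I. u - ?z i * v))\<^sup>2"
      by (simp add: prod.distrib N_def prod_norm[symmetric] prod_power_distrib)
    also have "(\<Prod>i\<in>I. u - ?z i * v) = S"
      unfolding S_def P_def N_def by (rule prod_linear_homogenized[OF I])
    finally have "of_real (D * (\<Prod>i\<in>I. (norm (p - x i))\<^sup>2)) = 2 ^ N * (S * cnj S)"
      by (simp flip: complex_norm_square)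
    also have "S * cnj S = (\<Sum>j\<le>N. \<Sum>k\<le>N. coeff P j * cnj (coeff P k) *
        (u ^ j * v ^ (N - j) * cnj (u ^ k * v ^ (N - k))))"
      unfolding S_def cnj_sum sum_product by (simp add: mult_ac)
    also have "\<dots> = (\<Sum>j\<le>N. \<Sum>k\<le>N. coeff P j * cnj (coeff P k) * cross_term N j k p)"
      by (intro sum.cong refl) (simp only: cross_term_spinor[OF uv] atMost_iff)
    finally show ?thesis .
  qed
  \<comment> \<open>The integral is moved to the complex numbers because the individual cross terms
    are complex-valued.\<close>
  have "complex_of_real (D * (\<integral>p. (\<Prod>i\<in>I. (norm (p - x i))\<^sup>2) \<partial>sphere_sigma))
      = (\<integral>p. of_real (D * (\<Prod>i\<in>I. (norm (p - x i))\<^sup>2)) \<partial>sphere_sigma)"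
    by (simp only: integral_complex_of_real integral_mult_right_zero)
  also have "\<dots> = (\<integral>p. 2 ^ N * (\<Sum>j\<le>N. \<Sum>k\<le>N. coeff P j * cnj (coeff P k) * cross_term N j k p) \<partial>sphere_sigma)"
    by (rule integral_cong_sphere) (auto intro!: continuous_intros continuous_on_cross_term expand simp del: of_real_mult of_real_prod)
  also have "\<dots> = 2 ^ N * (\<Sum>j\<le>N. \<Sum>k\<le>N. coeff P j * cnj (coeff P k) * (\<integral>p. cross_term N j k p \<partial>sphere_sigma))"
    by (simp add: Bochner_Integration.integral_sum integrable_sphere_sigma continuous_on_cross_term
        continuous_on_sum continuous_on_mult)
  also have "\<dots> = 2 ^ N * (\<Sum>j\<le>N. coeff P j * cnj (coeff P j) * of_real (2 ^ N / (real (Suc N) * real (N choose j))))"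
    by (intro arg_cong2[where f = "(*)"] refl sum.cong)
      (simp add: integral_cross_term if_distrib cong: if_cong)
  also have "\<dots> = of_real (2 ^ N * (\<Sum>j\<le>N. (cmod (coeff P j))\<^sup>2 * (2 ^ N / (real (Suc N) * real (N choose j)))))"
    by (simp flip: complex_norm_square)
  \<comment> \<open>One factor 2^N comes from the pointwise identity for |p - x_i|^2, the other from
    the moments; together they form 4^N.\<close>
  also have "2 ^ N * (\<Sum>j\<le>N. (cmod (coeff P j))\<^sup>2 * (2 ^ N / (real (Suc N) * real (N choose j))))
      = 4 ^ N / real (N + 1) * (\<Sum>j\<le>N. (cmod (coeff P j))\<^sup>2 / real (N choose j))"
  proof -
    have "(4::real) ^ N = 2 ^ N * 2 ^ N"
      by (simp flip: power_mult_distrib)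
    then show ?thesis
      by (simp add: sum_distrib_left field_simps)
  qed
  also have "(\<Sum>j\<le>N. (cmod (coeff P j))\<^sup>2 / real (N choose j)) = (bw_norm P)\<^sup>2"
    by (simp add: bw_norm_def deg sum_nonneg)
  finally have eq: "D * (\<integral>p. (\<Prod>i\<in>I. (norm (p - x i))\<^sup>2) \<partial>sphere_sigma) = 4 ^ N / real (N + 1) * (bw_norm P)\<^sup>2"
    by (simp only: of_real_eq_iff)
  have "(\<integral>p. (\<Prod>i\<in>I. (norm (p - x i))\<^sup>2) \<partial>sphere_sigma)
      = 4 ^ N / real (N + 1) * (bw_norm P)\<^sup>2 / D"
    unfolding eq[symmetric] using D by simp
  then show ?thesis
    by (simp add: D_def)
qed

theorem theorem4p2:
  fixes N :: nat and z :: "nat \<Rightarrow> complex" and x :: "nat \<Rightarrow> real^3"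
  assumes "\<And>i. i \<in> {1..N} \<Longrightarrow> x i \<in> sphere 0 1"
    and "\<And>i. i \<in> {1..N} \<Longrightarrow> x i $ 3 \<noteq> 1"
    and "\<And>i. i \<in> {1..N} \<Longrightarrow> stereo (x i) = z i"
  shows "(\<Prod>i=1..N. bw_norm [:- z i, 1:]) / bw_norm (\<Prod>i=1..N. [:- z i, 1:])
       = 2 ^ N / sqrt (real N + 1)
         * (LINT p : sphere 0 1 | sphere_sigma. (\<Prod>i=1..N. (norm (p - x i))\<^sup>2)) powr (-1/2)"
proof -
  define W where "W = bw_norm (\<Prod>i=1..N. [:- z i, 1:])"
  define D where "D = (\<Prod>i=1..N. 1 + (cmod (z i))\<^sup>2)"
  define J where "J = (LINT p : sphere 0 1 | sphere_sigma. (\<Prod>i=1..N. (norm (p - x i))\<^sup>2))"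
  have D: "D > 0"
    unfolding D_def by (intro prod_pos) (simp add: add_pos_nonneg)
  have W: "W \<ge> 0"
    unfolding W_def bw_norm_def by (intro real_sqrt_ge_zero sum_nonneg) auto
  \<comment> \<open>In degree 1 both binomial weights are 1.\<close>
  have factor: "bw_norm [:- z i, 1:] = sqrt (1 + (cmod (z i))\<^sup>2)" for i
    by (simp add: bw_norm_def atMost_Suc add.commute)
  have "(\<Prod>i=1..N. bw_norm [:- z i, 1:]) = sqrt D"
    unfolding factor D_def by (induction N) (auto simp: real_sqrt_mult)
  \<comment> \<open>Restricting to the sphere changes nothing, since the measure is concentrated
    there.\<close>
  moreover have "J = (\<integral>p. (\<Prod>i=1..N. (norm (p - x i))\<^sup>2) \<partial>sphere_sigma)"
    unfolding J_def set_lebesgue_integral_def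
  proof (rule integral_cong_AE)
    show "AE p in sphere_sigma. indicator (sphere 0 1) p *\<^sub>R (\<Prod>i=1..N. (norm (p - x i))\<^sup>2)
        = (\<Prod>i=1..N. (norm (p - x i))\<^sup>2)"
      using AE_sphere_sigma by eventually_elim simp
    have [measurable]: "sphere (0::real^3) 1 \<in> sets borel"
      by (simp add: borel_closed)
    show "(\<lambda>p. indicator (sphere 0 1) p *\<^sub>R (\<Prod>i=1..N. (norm (p - x i))\<^sup>2)) \<in> borel_measurable sphere_sigma"
      by measurable
  qed auto
  moreover have "\<dots> = 4 ^ N * W\<^sup>2 / (real (N + 1) * D)"
    using assms integral_norm_prod_sphere[of "{1..N}" x] by (simp add: W_def D_def)
  ultimately have num: "(\<Prod>i=1..N. bw_norm [:- z i, 1:]) = sqrt D" and J: "J = 4 ^ N * W\<^sup>2 / (real (N + 1) * D)"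
    by auto
  have "sqrt (4 ^ N) = 2 ^ N"
    by (simp add: real_sqrt_power)
  then have "sqrt J = 2 ^ N * W / (sqrt (real N + 1) * sqrt D)"
    using W by (simp add: J real_sqrt_mult real_sqrt_divide add.commute)
  \<comment> \<open>Nonnegativity of \<open>J\<close> suffices: at 0 both sides take the default
    value 0, so no strict positivity of \<open>W\<close> has to be established.\<close>
  moreover have "J powr (-1/2) = 1 / sqrt J"
    using D by (simp add: powr_minus_divide powr_half_sqrt J)
  ultimately show ?thesis
    unfolding num J_def[symmetric] W_def[symmetric] by simp
qed

end
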